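(* Let $f:\mathbb{R}^n\times\mathbb{R}_{\ge 0}\to\mathbb{R}$ satisfy the Lipschitz gradient condition with constant $M>0$ and the smoothness condition with constants $K_1,K_2,K_3\ge 0$ (stated in the context). Let $\epsilon>0$, $t_k\ge 0$, $\delta>0$, $t_{k+1}=t_k+\delta$, and $\mathbf{x}_k\in\mathbb{R}^n$. Let $f^-_g(t_{k+1})=f(\mathbf{x}_k,t_{k+1})$ be the function value after the prediction step $\mathbf{x}^-_{k+1}=\mathbf{x}_k$ of the gradient descent algorithm, and let $f^-_1(t_{k+1})=f(\mathbf{x}^-_{k+1},t_{k+1})$ be the function value after the prediction step of Algorithm 1 (described in the context), both started from the same $\mathbf{x}_k$. Then $$f^-_1(t_{k+1})\le f^-_g(t_{k+1})$$ provided that $0<\delta\le\dfrac{2\epsilon^2}{K_1M+2\epsilon K_2}$.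
   Context: Notation: $\|\cdot\|$ is the Euclidean norm; $\nabla_{\mathbf{x}}f$, $\nabla_t f$, $\nabla_{\mathbf{x}t}f$, $\nabla_{tt}f$ denote partial derivatives of first and second order. Lipschitz gradient condition: $f$ is twice differentiable in $\mathbf{x}$ and, for all $t\ge0$ and all $\mathbf{x},\mathbf{z}\in\mathbb{R}^n$, $(\mathbf{z}-\mathbf{x})^\top(\nabla_{\mathbf{x}}f(\mathbf{z},t)-\nabla_{\mathbf{x}}f(\mathbf{x},t))\le M\|\mathbf{z}-\mathbf{x}\|^2$. Smoothness condition: $f$ is continuously differentiable and sufficiently smooth (meaning here twice continuously differentiable jointly in $(\mathbf{x},t)$), with $|\nabla_tf(\mathbf{x},t)|\le K_1$, $\|\nabla_{\mathbf{x}t}f(\mathbf{x},t)\|\le K_2$, $|\nabla_{tt}f(\mathbf{x},t)|\le K_3$ for all $\mathbf{x}\in\mathbb{R}^n$, $t\ge0$. Prediction step of Algorithm 1: $\mathbf{x}^-_{k+1}=\mathbf{x}_k-\delta\frac{|\nabla_tf(\mathbf{x}_k,t_k)|}{\|\nabla_{\mathbf{x}}f(\mathbf{x}_k,t_k)\|^2}\nabla_{\mathbf{x}}f(\mathbf{x}_k,t_k)$ if $\|\nabla_{\mathbf{x}}f(\mathbf{x}_k,t_k)\|\ge\epsilon$, and $\mathbf{x}^-_{k+1}=\mathbf{x}_k$ otherwise. *)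

theory Defs
  imports "HOL-Analysis.Analysis"
begin

text \<open>
  A function on $R^n \times [0,\infty)$ is a curried function on \<^typ>\<open>real ^ 'n\<close> and
  \<^typ>\<open>real\<close> whose values at negative times are irrelevant: time derivatives are taken
  within \<^term>\<open>{0::real..}\<close>, hence are right derivatives at time \<open>0\<close>.
\<close>

definition grad_x :: "(real ^ 'n \<Rightarrow> real \<Rightarrow> real) \<Rightarrow> real ^ 'n \<Rightarrow> real \<Rightarrow> real ^ 'n" where
  "grad_x f x t = (THE g. GDERIV (\<lambda>y. f y t) x :> g)"

definition deriv_t :: "(real ^ 'n \<Rightarrow> real \<Rightarrow> real) \<Rightarrow> real ^ 'n \<Rightarrow> real \<Rightarrow> real" where
  "deriv_t f x t = vector_derivative (\<lambda>s. f x s) (at t within {0..})"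

text \<open>
  For jointly twice continuously differentiable functions the order of the mixed derivatives is
  immaterial.
\<close>

definition deriv_xt :: "(real ^ 'n \<Rightarrow> real \<Rightarrow> real) \<Rightarrow> real ^ 'n \<Rightarrow> real \<Rightarrow> real ^ 'n" where
  "deriv_xt f x t = vector_derivative (\<lambda>s. grad_x f x s) (at t within {0..})"

definition deriv_tt :: "(real ^ 'n \<Rightarrow> real \<Rightarrow> real) \<Rightarrow> real ^ 'n \<Rightarrow> real \<Rightarrow> real" where
  "deriv_tt f x t = vector_derivative (\<lambda>s. deriv_t f x s) (at t within {0..})"

text \<open>
  Twice continuously differentiable on a set. It is used only for
  \<^term>\<open>UNIV \<times> {0::real..}\<close>, which is convex with nonempty interior, so that derivatives
  within the set are unique.
\<close>

definition C2_on ::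
  "'a::real_normed_vector set \<Rightarrow> ('a \<Rightarrow> 'b::real_normed_vector) \<Rightarrow> bool" where
  "C2_on S F \<longleftrightarrow>
     (\<exists>(F' :: 'a \<Rightarrow> 'a \<Rightarrow>\<^sub>L 'b) (F'' :: 'a \<Rightarrow> 'a \<Rightarrow>\<^sub>L ('a \<Rightarrow>\<^sub>L 'b)).
        (\<forall>p\<in>S. (F has_derivative blinfun_apply (F' p)) (at p within S)) \<and>
        (\<forall>p\<in>S. (F' has_derivative blinfun_apply (F'' p)) (at p within S)) \<and>
        continuous_on S F'')"

definition lipschitz_gradient :: "real \<Rightarrow> (real ^ 'n \<Rightarrow> real \<Rightarrow> real) \<Rightarrow> bool" where
  "lipschitz_gradient M f \<longleftrightarrow>
     (\<forall>t\<ge>0. \<forall>x. (\<lambda>y. f y t) differentiable (at x) \<and> (\<lambda>y. grad_x f y t) differentiable (at x)) \<and>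
     (\<forall>t\<ge>0. \<forall>x z. (z - x) \<bullet> (grad_x f z t - grad_x f x t) \<le> M * (norm (z - x))\<^sup>2)"

definition smoothness ::
  "real \<Rightarrow> real \<Rightarrow> real \<Rightarrow> (real ^ 'n \<Rightarrow> real \<Rightarrow> real) \<Rightarrow> bool" where
  "smoothness K1 K2 K3 f \<longleftrightarrow>
     C2_on (UNIV \<times> {0..}) (\<lambda>(x, t). f x t) \<and>
     (\<forall>x. \<forall>t\<ge>0. \<bar>deriv_t f x t\<bar> \<le> K1 \<and> norm (deriv_xt f x t) \<le> K2 \<and> \<bar>deriv_tt f x t\<bar> \<le> K3)"

definition gd_prediction :: "real ^ 'n \<Rightarrow> real ^ 'n" where
  "gd_prediction x = x"

definition alg1_prediction ::
  "(real ^ 'n \<Rightarrow> real \<Rightarrow> real) \<Rightarrow> real \<Rightarrow> real \<Rightarrow> real ^ 'n \<Rightarrow> real \<Rightarrow> real ^ 'n" where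
  "alg1_prediction f \<epsilon> \<delta> x t =
     (if norm (grad_x f x t) \<ge> \<epsilon>
      then x - (\<delta> * (\<bar>deriv_t f x t\<bar> / (norm (grad_x f x t))\<^sup>2)) *\<^sub>R grad_x f x t
      else x)"

end

theory Submission imports Defs begin

text \<open>
  Write \<open>g\<close> and \<open>D\<close> for the spatial gradients of \<open>f\<close> at the current point at the times
  \<open>t\<^sub>k\<close> and \<open>t\<^sub>k\<^sub>1\<close>. The prediction moves along \<open>- g\<close> with step length
  \<open>s = \<delta> * \<bar>\<nabla>\<^sub>t f\<bar> / (norm g)\<^sup>2\<close>, while the value that has to decrease is that of
  \<open>f\<close> at the later time \<open>t\<^sub>k\<^sub>1\<close>, whose steepest descent direction is \<open>- D\<close>. Two estimates
  show that the stale gradient is good enough.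

  First, the one-sided Lipschitz condition bounds \<open>f\<close> at time \<open>t\<^sub>k\<^sub>1\<close> above by a quadratic along
  every ray from the current point (\<open>descent_upper_bound\<close>): the change of the value is at most
  \<open>- s * (g \<bullet> D) + M * s\<^sup>2 * (norm g)\<^sup>2 / 2\<close>.
  Second, the bound \<open>K2\<close> on the mixed derivative limits how far the gradient drifts
  (\<open>gradient_drift_bound\<close>): \<open>norm (D - g) \<le> K2 * \<delta>\<close>, so
  \<open>g \<bullet> D \<ge> norm g * (norm g - K2 * \<delta>)\<close>. As
  \<open>s * (norm g)\<^sup>2 \<le> \<delta> * K1\<close>, there is no increase as soon as
  \<open>M * \<delta> * K1 / 2 \<le> norm g * (norm g - K2 * \<delta>)\<close>. For \<open>norm g = \<epsilon>\<close> this is the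
  assumed bound on \<open>\<delta>\<close>, and the right-hand side grows with \<open>norm g \<ge> \<epsilon>\<close>. When
  \<open>norm g < \<epsilon>\<close> both methods stay put.
\<close>

lemma grad_x_works:
  fixes f :: "real ^ 'n \<Rightarrow> real \<Rightarrow> real"
  assumes "(\<lambda>y. f y t) differentiable (at x)"
  shows "GDERIV (\<lambda>y. f y t) x :> grad_x f x t"
proof -
  obtain L where L: "((\<lambda>y. f y t) has_derivative L) (at x)"
    using assms by (auto simp: differentiable_def)
  have "linear L"
    using L by (rule has_derivative_linear)
  then have "L = (\<lambda>h. h \<bullet> adjoint L 1)"
    using adjoint_works[of L _ 1] by (auto simp: fun_eq_iff)
  then have g: "GDERIV (\<lambda>y. f y t) x :> adjoint L 1"
    using L by (simp add: gderiv_def)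
  have "g' = adjoint L 1" if "GDERIV (\<lambda>y. f y t) x :> g'" for g'
  proof -
    have "(\<lambda>h. h \<bullet> g') = (\<lambda>h. h \<bullet> adjoint L 1)"
      using that g has_derivative_unique unfolding gderiv_def by blast
    then have "h \<bullet> g' = h \<bullet> adjoint L 1" for h
      by (rule fun_cong)
    then have "\<forall>h. h \<bullet> g' = h \<bullet> adjoint L 1"
      by (rule allI)
    then show ?thesis
      by (rule iffD1[OF vector_eq_ldot])
  qed
  then show ?thesis
    unfolding grad_x_def by (rule theI[where P = "\<lambda>g. GDERIV (\<lambda>y. f y t) x :> g", OF g])
qed

text \<open>
  Only monotonicity of the gradient up to \<open>M\<close> is available, not a two-sided Lipschitz bound. It
  suffices because the derivative of \<open>f\<close> along the ray from \<open>x\<close> with direction \<open>v\<close> compares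
  the gradient at \<open>x + s *\<^sub>R v\<close> with that at \<open>x\<close> precisely in the direction of the displacement,
  and an upper bound on that derivative is all that an upper bound on \<open>f\<close> needs.
\<close>
lemma descent_upper_bound:
  fixes f :: "real ^ 'n \<Rightarrow> real \<Rightarrow> real"
  assumes lip: "lipschitz_gradient M f" and t: "t \<ge> 0" and s: "s \<ge> 0"
  shows "f (x + s *\<^sub>R v) t \<le> f x t + s * (v \<bullet> grad_x f x t) + M * s\<^sup>2 * (norm v)\<^sup>2 / 2"
proof -
  define \<psi> where "\<psi> r = f (x + r *\<^sub>R v) t - r * (v \<bullet> grad_x f x t) - M * r\<^sup>2 * (norm v)\<^sup>2 / 2" for r
  have "\<exists>y. (\<psi> has_real_derivative y) (at r) \<and> y \<le> 0" if "0 \<le> r" for r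
  proof -
    let ?z = "x + r *\<^sub>R v"
    have "GDERIV (\<lambda>y. f y t) ?z :> grad_x f ?z t"
      using lip t by (intro grad_x_works) (auto simp: lipschitz_gradient_def)
    then have "((\<lambda>y. f y t) has_derivative (\<lambda>h. h \<bullet> grad_x f ?z t)) (at ?z)"
      by (simp add: gderiv_def)
    then have "((\<lambda>r. f (x + r *\<^sub>R v) t) has_derivative (\<lambda>h. (h *\<^sub>R v) \<bullet> grad_x f ?z t)) (at r)"
      by (rule has_derivative_compose[rotated]) (auto intro!: derivative_eq_intros)
    then have "((\<lambda>r. f (x + r *\<^sub>R v) t) has_real_derivative (v \<bullet> grad_x f ?z t)) (at r)"
      by (rule has_derivative_imp_has_field_derivative) simp
    then have "(\<psi> has_real_derivative
        (v \<bullet> grad_x f ?z t - v \<bullet> grad_x f x t - M * r * (norm v)\<^sup>2)) (at r)"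
      unfolding \<psi>_def by (auto intro!: derivative_eq_intros)
    moreover have "v \<bullet> grad_x f ?z t - v \<bullet> grad_x f x t - M * r * (norm v)\<^sup>2 \<le> 0"
    proof (cases "r = 0")
      case False
      have "(?z - x) \<bullet> (grad_x f ?z t - grad_x f x t) \<le> M * (norm (?z - x))\<^sup>2"
        using lip t unfolding lipschitz_gradient_def by blast
      then have "r * (v \<bullet> grad_x f ?z t - v \<bullet> grad_x f x t) \<le> r * (M * r * (norm v)\<^sup>2)"
        using that by (simp add: inner_diff_right power_mult_distrib power2_eq_square algebra_simps)
      then show ?thesis
        using False that by simp
    qed simp
    ultimately show ?thesis by blast
  qed
  then have "\<psi> s \<le> \<psi> 0"
    by (intro DERIV_nonpos_imp_nonincreasing[OF s]) blast
  then show ?thesis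
    by (simp add: \<psi>_def)
qed

text \<open>
  The mixed derivative in \<open>deriv_xt\<close> is a bare choice of a derivative of \<open>grad_x f x\<close>, so the
  bound on it is informative only where that derivative exists. It does, because each component
  of the gradient is the total derivative of \<open>f\<close> applied to a fixed vector, and the total
  derivative is differentiable.
\<close>
lemma grad_x_has_vector_derivative_deriv_xt:
  fixes f :: "real ^ 'n \<Rightarrow> real \<Rightarrow> real"
  assumes lip: "lipschitz_gradient M f" and C2: "C2_on (UNIV \<times> {0..}) (\<lambda>(x, t). f x t)"
    and t: "t \<ge> 0"
  shows "((\<lambda>s. grad_x f x s) has_vector_derivative deriv_xt f x t) (at t within {0..})"
proof -
  let ?S = "UNIV \<times> {0..} :: ((real ^ 'n) \<times> real) set"
  obtain F' F'' where
    F': "\<And>p. p \<in> ?S \<Longrightarrow> ((\<lambda>(x, t). f x t) has_derivative blinfun_apply (F' p)) (at p within ?S)"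
    and F'': "\<And>p. p \<in> ?S \<Longrightarrow> (F' has_derivative blinfun_apply (F'' p)) (at p within ?S)"
    using C2 unfolding C2_on_def by blast
  have grad_eq: "grad_x f x s = (\<chi> i. blinfun_apply (F' (x, s)) (axis i 1, 0))" if "s \<ge> 0" for s
  proof -
    have "((\<lambda>y. (y, s)) has_derivative (\<lambda>h. (h, 0))) (at x)"
      by (auto intro!: derivative_eq_intros)
    moreover have "((\<lambda>(x, t). f x t) has_derivative blinfun_apply (F' (x, s)))
        (at (x, s) within range (\<lambda>y. (y, s)))"
      using that by (intro has_derivative_subset[OF F']) auto
    ultimately have "((\<lambda>y. f y s) has_derivative (\<lambda>h. blinfun_apply (F' (x, s)) (h, 0))) (at x)"
      using has_derivative_in_compose[of "\<lambda>y. (y, s)" _ x UNIV "\<lambda>(x, t). f x t"] by simp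
    moreover have "((\<lambda>y. f y s) has_derivative (\<lambda>h. h \<bullet> grad_x f x s)) (at x)"
      using grad_x_works[of f s x] lip that by (auto simp: lipschitz_gradient_def gderiv_def)
    ultimately have "(\<lambda>h. blinfun_apply (F' (x, s)) (h, 0)) = (\<lambda>h. h \<bullet> grad_x f x s)"
      by (rule has_derivative_unique)
    then have "blinfun_apply (F' (x, s)) (h, 0) = h \<bullet> grad_x f x s" for h
      by (rule fun_cong)
    then show ?thesis
      by (simp add: vec_eq_iff inner_axis')
  qed
  have "((\<lambda>s. (x, s)) has_derivative (\<lambda>h. (0, h))) (at t within {0..})"
    by (auto intro!: derivative_eq_intros)
  moreover have "(F' has_derivative blinfun_apply (F'' (x, t)))
      (at (x, t) within (\<lambda>s. (x, s)) ` {0..})"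
    using t by (intro has_derivative_subset[OF F'']) auto
  ultimately have "((\<lambda>s. F' (x, s)) has_derivative (\<lambda>h. blinfun_apply (F'' (x, t)) (0, h)))
      (at t within {0..})"
    using has_derivative_in_compose[of "\<lambda>s. (x, s)" _ t "{0..}" F'] by simp
  then have "(\<lambda>s. F' (x, s)) differentiable (at t within {0..})"
    by (auto simp: differentiable_def)
  then obtain G where "((\<lambda>s. F' (x, s)) has_vector_derivative G) (at t within {0..})"
    unfolding vector_derivative_works by blast
  then have "((\<lambda>s. blinfun_apply (F' (x, s)) (axis i 1, 0)) has_vector_derivative
      blinfun_apply G (axis i 1, 0)) (at t within {0..})" for i
    by (rule bounded_linear.has_vector_derivative[OF blinfun.bounded_linear_left])
  then have "((\<lambda>s. \<chi> i. blinfun_apply (F' (x, s)) (axis i 1, 0)) has_vector_derivative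
      (\<chi> i. blinfun_apply G (axis i 1, 0))) (at t within {0..})"
    unfolding has_vector_derivative_def
    by (subst has_derivative_componentwise_within) (auto simp: Basis_vec_def inner_axis)
  then have "((\<lambda>s. grad_x f x s) has_vector_derivative
      (\<chi> i. blinfun_apply G (axis i 1, 0))) (at t within {0..})"
    using t grad_eq by (auto intro: has_vector_derivative_transform)
  then show ?thesis
    unfolding deriv_xt_def
    using differentiableI_vector vector_derivative_works by blast
qed

lemma gradient_drift_bound:
  fixes f :: "real ^ 'n \<Rightarrow> real \<Rightarrow> real"
  assumes lip: "lipschitz_gradient M f" and sm: "smoothness K1 K2 K3 f"
    and "t \<ge> 0" "t' \<ge> 0"
  shows "norm (grad_x f x t' - grad_x f x t) \<le> K2 * \<bar>t' - t\<bar>"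
proof -
  have "norm (grad_x f x t' - grad_x f x t) \<le> K2 * norm (t' - t)"
  proof (rule differentiable_bound[where S = "{0..}"])
    fix s :: real assume s: "s \<in> {0..}"
    show "((\<lambda>s. grad_x f x s) has_derivative (\<lambda>h. h *\<^sub>R deriv_xt f x s)) (at s within {0..})"
      using grad_x_has_vector_derivative_deriv_xt[OF lip, of s x] s sm
      by (simp add: smoothness_def has_vector_derivative_def)
    have "norm (deriv_xt f x s) \<le> K2"
      using s sm by (simp add: smoothness_def)
    then show "onorm (\<lambda>h. h *\<^sub>R deriv_xt f x s) \<le> K2"
      by (intro onorm_le) (simp add: mult.commute[of K2] mult_left_mono)
  qed (use assms in auto)
  then show ?thesis by simp
qed

theorem lemma4p1:
  fixes f :: "real ^ 'n \<Rightarrow> real \<Rightarrow> real"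
    and M K1 K2 K3 \<epsilon> \<delta> t\<^sub>k t\<^sub>k\<^sub>1 :: real
    and x\<^sub>k :: "real ^ 'n"
  assumes "M > 0" and "K1 \<ge> 0" and "K2 \<ge> 0" and "K3 \<ge> 0"
    and "lipschitz_gradient M f"
    and "smoothness K1 K2 K3 f"
    and "\<epsilon> > 0" and "t\<^sub>k \<ge> 0" and "\<delta> > 0" and "t\<^sub>k\<^sub>1 = t\<^sub>k + \<delta>"
    (* for a zero denominator the bound reads as plus infinity *)
    and "K1 * M + 2 * \<epsilon> * K2 \<noteq> 0 \<Longrightarrow> \<delta> \<le> 2 * \<epsilon>\<^sup>2 / (K1 * M + 2 * \<epsilon> * K2)"
  shows "f (alg1_prediction f \<epsilon> \<delta> x\<^sub>k t\<^sub>k) t\<^sub>k\<^sub>1 \<le> f (gd_prediction x\<^sub>k) t\<^sub>k\<^sub>1"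
proof (cases "norm (grad_x f x\<^sub>k t\<^sub>k) \<ge> \<epsilon>")
  case False
  then show ?thesis
    by (simp add: alg1_prediction_def gd_prediction_def)
next
  case True
  define g where "g = grad_x f x\<^sub>k t\<^sub>k"
  define D where "D = grad_x f x\<^sub>k t\<^sub>k\<^sub>1"
  define a where "a = \<bar>deriv_t f x\<^sub>k t\<^sub>k\<bar>"
  define s where "s = \<delta> * (a / (norm g)\<^sup>2)"
  have g: "norm g \<ge> \<epsilon>" "norm g > 0"
    using True \<open>\<epsilon> > 0\<close> by (auto simp: g_def)
  have a: "0 \<le> a" "a \<le> K1"
    using assms(6,8) by (auto simp: a_def smoothness_def)
  have s: "s \<ge> 0" "s * (norm g)\<^sup>2 = \<delta> * a"
    using a g \<open>\<delta> > 0\<close> by (auto simp: s_def)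
  have step: "alg1_prediction f \<epsilon> \<delta> x\<^sub>k t\<^sub>k = x\<^sub>k + s *\<^sub>R (- g)"
    using True by (simp add: alg1_prediction_def s_def a_def g_def)
  have "norm (D - g) \<le> K2 * \<delta>"
    using gradient_drift_bound[OF assms(5,6), of t\<^sub>k t\<^sub>k\<^sub>1 x\<^sub>k] assms(8-10) by (simp add: D_def g_def)
  then have "norm g * norm (D - g) \<le> norm g * (K2 * \<delta>)"
    by (rule mult_left_mono) simp
  moreover have "- (norm g * norm (D - g)) \<le> g \<bullet> (D - g)"
    using Cauchy_Schwarz_ineq2[of g "D - g"] by linarith
  ultimately have gD: "norm g * (norm g - K2 * \<delta>) \<le> g \<bullet> D"
    by (simp add: inner_diff_right dot_square_norm power2_eq_square algebra_simps)
  have "\<delta> * (K1 * M + 2 * \<epsilon> * K2) \<le> 2 * \<epsilon>\<^sup>2"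
  proof (cases "K1 * M + 2 * \<epsilon> * K2 = 0")
    case False
    moreover have "K1 * M + 2 * \<epsilon> * K2 \<ge> 0"
      using assms(1-3,7) by simp
    ultimately show ?thesis
      using assms(11) by (simp add: pos_le_divide_eq)
  qed simp
  then have \<epsilon>: "M * (\<delta> * K1) / 2 \<le> \<epsilon> * (\<epsilon> - K2 * \<delta>)"
    by (simp add: power2_eq_square algebra_simps)
  have "0 \<le> M * (\<delta> * K1) / 2"
    using assms(1,2,9) by simp
  with \<epsilon> have "0 \<le> \<epsilon> - K2 * \<delta>"
    using \<open>\<epsilon> > 0\<close> by (metis order_trans zero_le_mult_iff not_less)
  then have "\<epsilon> * (\<epsilon> - K2 * \<delta>) \<le> norm g * (norm g - K2 * \<delta>)"
    using g \<open>\<epsilon> > 0\<close> by (intro mult_mono) auto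
  moreover have "M * (s * (norm g)\<^sup>2) / 2 \<le> M * (\<delta> * K1) / 2"
    using a assms(1,9) unfolding s(2) by (simp add: mult_left_mono)
  ultimately have "M * (s * (norm g)\<^sup>2) / 2 \<le> g \<bullet> D"
    using \<epsilon> gD by linarith
  then have "s * (M * (s * (norm g)\<^sup>2) / 2) \<le> s * (g \<bullet> D)"
    using s(1) by (rule mult_left_mono)
  then have "- (s * (g \<bullet> D)) + M * s\<^sup>2 * (norm g)\<^sup>2 / 2 \<le> 0"
    by (simp add: power2_eq_square mult_ac)
  moreover have "f (x\<^sub>k + s *\<^sub>R (- g)) t\<^sub>k\<^sub>1
      \<le> f x\<^sub>k t\<^sub>k\<^sub>1 + s * (- g \<bullet> D) + M * s\<^sup>2 * (norm (- g))\<^sup>2 / 2"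
    using descent_upper_bound[OF assms(5), of t\<^sub>k\<^sub>1 s x\<^sub>k "- g"] s(1) assms(8-10)
    unfolding D_def by simp
  ultimately show ?thesis
    unfolding step gd_prediction_def by simp
qed

end
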